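(* Let $f:\mathbb{R}^2\to\mathbb{R}$ be a function in $C^2(\mathbb{R}^2)$ such that the functions $f$, $f_x$, $f_y$ and $f_{xy}$ are all in $L^1(\mathbb{R}^2)$. Then for each $(x,y)\in\mathbb{R}^2$, $$ f(x,y)=\frac{1}{(2\pi)^2}\lim_{R_1\to\infty}\lim_{R_2\to\infty}\int_{-R_1}^{R_1}\int_{-R_2}^{R_2} e^{i(xs+yt)} \int_{-\infty}^{\infty}\int_{-\infty}^{\infty} e^{-i(su+tv)}f(u,v)\,dv\,du\,dt\,ds. $$
   Context: Integrals are Lebesgue integrals. Subscripts denote partial derivatives with respect to the indicated variable. The limit is iterated: for each fixed $R_1$ one first lets $R_2\to\infty$, and then $R_1\to\infty$; the variable $s$ ranges over $[-R_1,R_1]$ and $t$ over $[-R_2,R_2]$. *)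

theory Defs
  imports "HOL-Analysis.Analysis"
begin

definition partial_x :: "(real \<times> real \<Rightarrow> real) \<Rightarrow> real \<times> real \<Rightarrow> real" where
  "partial_x f = (\<lambda>(x, y). deriv (\<lambda>u. f (u, y)) x)"

definition partial_y :: "(real \<times> real \<Rightarrow> real) \<Rightarrow> real \<times> real \<Rightarrow> real" where
  "partial_y f = (\<lambda>(x, y). deriv (\<lambda>v. f (x, v)) y)"

(* deriv has an unspecified value where the derivative does not exist, so the
   existence of the partial derivatives is required explicitly. *)
definition C1_plane :: "(real \<times> real \<Rightarrow> real) \<Rightarrow> bool" where
  "C1_plane f \<longleftrightarrow>
     continuous_on UNIV f \<and>
     (\<forall>x y. (\<lambda>u. f (u, y)) field_differentiable at x) \<and>
     (\<forall>x y. (\<lambda>v. f (x, v)) field_differentiable at y) \<and>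
     continuous_on UNIV (partial_x f) \<and>
     continuous_on UNIV (partial_y f)"

definition C2_plane :: "(real \<times> real \<Rightarrow> real) \<Rightarrow> bool" where
  "C2_plane f \<longleftrightarrow> C1_plane f \<and> C1_plane (partial_x f) \<and> C1_plane (partial_y f)"

end

theory Submission
  imports Defs "HOL-Probability.Sinc_Integral"
begin

text \<open>
  Write $D_R(w) = \int_{-R}^{R} e^{itw}\,dt = 2\sin(Rw)/w$ for the Dirichlet kernel. By Fubini
  the truncated inversion integral is
  $\int\!\int f(u,v)\, D_{R_1}(x-u)\, D_{R_2}(y-v)\,dv\,du$
  (\<open>truncated_inversion_eq_dirichlet\<close>), so that the theorem is about two successive limits of
  Dirichlet kernels.

  On the line, let $g$ be continuously differentiable with $g, g' \in L^1$. Then $g$ vanishes at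
  $\pm\infty$, and since $D_R(y-v)$ is the derivative of $-2\,\mathrm{Si}(R(y-v))$ in $v$,
  integration by parts gives
  $\int g(v) D_R(y-v)\,dv = \int g'(v)\, 2\,\mathrm{Si}(R(y-v))\,dv$
  (\<open>integral_mult_dirichlet\<close>). The sine integral is bounded and
  $2\,\mathrm{Si}(Rw) \to \pi\,\mathrm{sgn}(w)$, so this tends to
  $\pi \int g'(v)\,\mathrm{sgn}(y-v)\,dv = 2\pi g(y)$ by dominated convergence
  (\<open>dirichlet_tendsto\<close>), and it is bounded by a multiple of $\|g'\|_1$ uniformly in $R$
  (\<open>abs_integral_mult_dirichlet_le\<close>).

  As $R_2 \to \infty$, this applies to $g = f(u,\cdot)$ for almost every $u$, and the uniform
  bound, integrable in $u$ because $f_y \in L^1$, gives the limit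
  $2\pi \int f(u,y) D_{R_1}(x-u)\,du$ (\<open>dirichlet_tendsto_slice\<close>). As $R_1 \to \infty$, it applies
  to the single slice $g = f(\cdot,y)$ and yields $4\pi^2 f(x,y)$. That this particular slice is
  integrable together with $f_x(\cdot,y)$ does not follow from Fubini, which speaks of almost
  every slice only; it holds since $|h(u,y)| \le \int |h(u,v)| + |h_y(u,v)|\,dv$ for
  $h = f$ and $h = f_x$ (\<open>integrable_slice\<close>), and this is where $f_{xy} \in L^1$ enters.
\<close>

section \<open>Functions on the line that are integrable with their derivative\<close>

locale integrable_C1 =
  fixes g g' :: "real \<Rightarrow> real"
  assumes deriv: "\<And>v. (g has_real_derivative g' v) (at v)"
    and cont_deriv: "continuous_on UNIV g'"
    and integrable: "integrable lborel g"
    and integrable_deriv: "integrable lborel g'"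
begin

lemma cont: "continuous_on UNIV g"
  using deriv by (meson DERIV_isCont continuous_at_imp_continuous_on)

lemma borel_measurable [measurable]: "g \<in> borel_measurable borel" "g' \<in> borel_measurable borel"
  using cont cont_deriv by (auto intro: borel_measurable_continuous_onI)

lemma integrable_norms: "integrable lborel (\<lambda>v. \<bar>g v\<bar> + \<bar>g' v\<bar>)"
  using integrable integrable_deriv by auto

text \<open>
  This is the fundamental theorem of calculus for $(b+1-v)\,g(v)$ on $[b,b+1]$, which takes the
  value $g(b)$ at the left end and $0$ at the right end. The estimate serves twice: the window
  $[b,b+1]$ forces decay at infinity, and enlarging it to the whole line gives a bound uniform
  in $b$.
\<close>

lemma abs_le_unit_integral:
  "\<bar>g b\<bar> \<le> (LBINT v. indicator {b..b+1} v * (\<bar>g v\<bar> + \<bar>g' v\<bar>))"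
proof -
  define F' where "F' v = (b + 1 - v) * g' v - g v" for v
  have "(LBINT v. indicator {b..b+1} v *\<^sub>R F' v) = (b + 1 - (b + 1)) * g (b + 1) - (b + 1 - b) * g b"
  proof (rule integral_FTC_atLeastAtMost)
    fix v :: real
    have "((\<lambda>v. (b + 1 - v) * g v) has_real_derivative F' v) (at v)"
      unfolding F'_def by (rule derivative_eq_intros deriv refl | simp)+
    then show "((\<lambda>v. (b + 1 - v) * g v) has_vector_derivative F' v) (at v within {b..b+1})"
      by (metis has_field_derivative_at_within has_real_derivative_iff_has_vector_derivative)
  next
    show "continuous_on {b..b+1} F'"
      unfolding F'_def
      by (intro continuous_intros continuous_on_subset[OF cont] continuous_on_subset[OF cont_deriv]) auto
  qed simp
  then have "\<bar>g b\<bar> = \<bar>LBINT v. indicator {b..b+1} v *\<^sub>R F' v\<bar>"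
    by simp
  also have "\<dots> \<le> (LBINT v. \<bar>indicator {b..b+1} v *\<^sub>R F' v\<bar>)"
    by (rule integral_abs_bound)
  also have "\<dots> \<le> (LBINT v. indicator {b..b+1} v * (\<bar>g v\<bar> + \<bar>g' v\<bar>))"
  proof (rule integral_mono_AE')
    show "integrable lborel (\<lambda>v. indicator {b..b+1} v * (\<bar>g v\<bar> + \<bar>g' v\<bar>))"
      using integrable_mult_indicator[OF _ integrable_norms, of "{b..b+1}"] by simp
    have "\<bar>F' v\<bar> \<le> \<bar>g v\<bar> + \<bar>g' v\<bar>" if "v \<in> {b..b+1}" for v
    proof -
      have "\<bar>(b + 1 - v) * g' v\<bar> \<le> 1 * \<bar>g' v\<bar>"
        unfolding abs_mult using that by (intro mult_right_mono) auto
      then show ?thesis by (simp add: F'_def)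
    qed
    then show "AE v in lborel. \<bar>indicator {b..b+1} v *\<^sub>R F' v\<bar> \<le> indicator {b..b+1} v * (\<bar>g v\<bar> + \<bar>g' v\<bar>)"
      by (auto split: split_indicator)
  qed auto
  finally show ?thesis .
qed

lemma abs_le_integral: "\<bar>g b\<bar> \<le> (LBINT v. \<bar>g v\<bar> + \<bar>g' v\<bar>)"
proof -
  have "(LBINT v. indicator {b..b+1} v * (\<bar>g v\<bar> + \<bar>g' v\<bar>)) \<le> (LBINT v. \<bar>g v\<bar> + \<bar>g' v\<bar>)"
    by (rule integral_mono_AE'[OF integrable_norms]) (auto split: split_indicator)
  then show ?thesis
    using abs_le_unit_integral[of b] by linarith
qed

text \<open>The reflection carries the behaviour at $+\infty$ over to $-\infty$.\<close>

lemma reflected: "integrable_C1 (\<lambda>v. g (- v)) (\<lambda>v. - g' (- v))"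
proof
  fix v
  show "((\<lambda>v. g (- v)) has_real_derivative - g' (- v)) (at v)"
    using deriv[of "- v"] by (simp add: DERIV_mirror)
next
  show "continuous_on UNIV (\<lambda>v. - g' (- v))"
    by (intro continuous_intros continuous_on_compose2[OF cont_deriv]) auto
  show "integrable lborel (\<lambda>v. g (- v))"
    using lborel_integrable_real_affine[OF integrable, of "-1" 0] by simp
  show "integrable lborel (\<lambda>v. - g' (- v))"
    using lborel_integrable_real_affine[OF integrable_deriv, of "-1" 0] by simp
qed

lemma tendsto_at_top: "(g \<longlongrightarrow> 0) at_top"
proof (rule Lim_null_comparison)
  show "\<forall>\<^sub>F b in at_top. norm (g b) \<le> (LBINT v. indicator {b..b+1} v * (\<bar>g v\<bar> + \<bar>g' v\<bar>))"
    using abs_le_unit_integral by simp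
  have "((\<lambda>b. LBINT v. indicator {b..b+1} v * (\<bar>g v\<bar> + \<bar>g' v\<bar>)) \<longlongrightarrow> (LBINT v::real. 0)) at_top"
  proof (rule integral_dominated_convergence_at_top[OF _ _ integrable_norms])
    have "\<forall>\<^sub>F b in at_top. indicator {b..b+1} v * (\<bar>g v\<bar> + \<bar>g' v\<bar>) = 0" for v
      using eventually_gt_at_top[of v] by eventually_elim auto
    then show "AE v in lborel. ((\<lambda>b. indicator {b..b+1} v * (\<bar>g v\<bar> + \<bar>g' v\<bar>)) \<longlongrightarrow> 0) at_top"
      by (intro AE_I2 tendsto_eventually)
    show "\<forall>\<^sub>F b in at_top. AE v in lborel. norm (indicator {b..b+1} v * (\<bar>g v\<bar> + \<bar>g' v\<bar>)) \<le> \<bar>g v\<bar> + \<bar>g' v\<bar>"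
      by (intro always_eventually allI AE_I2) (auto split: split_indicator)
  qed auto
  then show "((\<lambda>b. LBINT v. indicator {b..b+1} v * (\<bar>g v\<bar> + \<bar>g' v\<bar>)) \<longlongrightarrow> 0) at_top"
    by simp
qed

lemma tendsto_at_bot: "(g \<longlongrightarrow> 0) at_bot"
  using integrable_C1.tendsto_at_top[OF reflected] by (simp add: filterlim_at_bot_mirror)

text \<open>
  Each of the half-lines on the two sides of $y$ contributes $g(y)$, as $g$ vanishes at both
  infinite ends.
\<close>

lemma integral_deriv_mult_sgn: "(LBINT v. g' v * sgn (y - v)) = 2 * g y"
proof -
  have left: "(LBINT v=-\<infinity>..ereal y. g' v) = g y - 0"
  proof (rule interval_integral_FTC_integrable[where F = g])
    show "((g \<circ> real_of_ereal) \<longlongrightarrow> 0) (at_right (- \<infinity>))"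
      using tendsto_at_bot by (simp add: ereal_tendsto_simps)
    show "((g \<circ> real_of_ereal) \<longlongrightarrow> g y) (at_left (ereal y))"
      using DERIV_isCont[OF deriv, of y] filterlim_at_split
      by (auto simp: ereal_tendsto_simps isCont_def)
    show "set_integrable lborel (einterval (- \<infinity>) (ereal y)) g'"
      unfolding set_integrable_def by (intro integrable_mult_indicator integrable_deriv) auto
  qed (use deriv cont_deriv in \<open>auto simp: continuous_on_eq_continuous_at
        simp flip: has_real_derivative_iff_has_vector_derivative\<close>)
  have right: "(LBINT v=ereal y..\<infinity>. g' v) = 0 - g y"
  proof (rule interval_integral_FTC_integrable[where F = g])
    show "((g \<circ> real_of_ereal) \<longlongrightarrow> 0) (at_left \<infinity>)"
      using tendsto_at_top by (simp add: ereal_tendsto_simps)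
    show "((g \<circ> real_of_ereal) \<longlongrightarrow> g y) (at_right (ereal y))"
      using DERIV_isCont[OF deriv, of y] filterlim_at_split
      by (auto simp: ereal_tendsto_simps isCont_def)
    show "set_integrable lborel (einterval (ereal y) \<infinity>) g'"
      unfolding set_integrable_def by (intro integrable_mult_indicator integrable_deriv) auto
  qed (use deriv cont_deriv in \<open>auto simp: continuous_on_eq_continuous_at
        simp flip: has_real_derivative_iff_has_vector_derivative\<close>)
  have "(LBINT v. g' v * sgn (y - v)) =
      (LBINT v. indicator {..<y} v *\<^sub>R g' v - indicator {y<..} v *\<^sub>R g' v)"
    by (intro Bochner_Integration.integral_cong) (auto simp: sgn_if split: split_indicator)
  also have "\<dots> = (LBINT v. indicator {..<y} v *\<^sub>R g' v) - (LBINT v. indicator {y<..} v *\<^sub>R g' v)"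
    by (intro Bochner_Integration.integral_diff integrable_mult_indicator integrable_deriv) auto
  finally show ?thesis
    using left right by (simp add: interval_lebesgue_integral_def set_lebesgue_integral_def)
qed

end

section \<open>Fourier inversion on the line by the sine integral\<close>

text \<open>
  The kernel $2\sin(Rw)/w$, written with \<open>sinc\<close> so that it is continuous at $w = 0$, where it
  takes the value $2R$.
\<close>

definition dirichlet :: "real \<Rightarrow> real \<Rightarrow> real" where
  "dirichlet R w = 2 * R * sinc (R * w)"

lemma isCont_dirichlet: "isCont (dirichlet R) w"
proof -
  have "continuous_on UNIV (dirichlet R)"
    unfolding dirichlet_def by (intro continuous_intros)
  then show ?thesis by (simp add: continuous_on_eq_continuous_at)
qed

lemma measurable_dirichlet [measurable]: "dirichlet R \<in> borel_measurable borel"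
  by (intro borel_measurable_continuous_onI continuous_at_imp_continuous_on ballI isCont_dirichlet)

lemma abs_dirichlet_le: "\<bar>dirichlet R w\<bar> \<le> 2 * \<bar>R\<bar>"
proof -
  have "\<bar>sinc z\<bar> \<le> 1" for z
    using abs_sin_x_le_abs_x[of z] by (auto simp: divide_simps)
  then have "2 * \<bar>R\<bar> * \<bar>sinc (R * w)\<bar> \<le> 2 * \<bar>R\<bar>"
    by (rule mult_left_le) simp
  then show ?thesis
    by (simp only: dirichlet_def abs_mult abs_numeral)
qed

lemma integral_exp_eq_dirichlet:
  assumes "0 \<le> R"
  shows "(LBINT t:{-R..R}. exp (\<i> * complex_of_real (t * w))) = complex_of_real (dirichlet R w)"
proof (cases "w = 0")
  case True
  then show ?thesis
    using assms by (simp add: dirichlet_def set_integral_const scaleR_conv_of_real) 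
next
  case False
  define F where "F t = exp (\<i> * complex_of_real (t * w)) / (\<i> * w)" for t :: real
  have "(LBINT t. indicator {-R..R} t *\<^sub>R exp (\<i> * complex_of_real (t * w))) = F R - F (- R)"
  proof (rule integral_FTC_atLeastAtMost)
    fix t :: real
    have "((\<lambda>z. exp (\<i> * (z * w)) / (\<i> * w)) has_field_derivative exp (\<i> * (t * w))) (at (of_real t))"
      using False by (auto intro!: derivative_eq_intros simp: field_simps)
    then have "((\<lambda>t. exp (\<i> * (complex_of_real t * w)) / (\<i> * w)) has_vector_derivative exp (\<i> * (t * w))) (at t)"
      by (rule has_vector_derivative_real_field)
    then show "(F has_vector_derivative exp (\<i> * complex_of_real (t * w))) (at t within {-R..R})"
      unfolding F_def by (auto intro: has_vector_derivative_at_within)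
  qed (use assms in \<open>auto intro!: continuous_intros\<close>)
  also have "\<dots> = complex_of_real (dirichlet R w)"
  proof (cases "R = 0")
    case True
    then show ?thesis by (simp add: F_def dirichlet_def)
  next
    case R: False
    have "F R - F (- R) = (2 * \<i> * complex_of_real (sin (R * w))) / (\<i> * w)"
      unfolding F_def exp_Euler sin_of_real cos_of_real
      by (simp add: diff_divide_distrib add_divide_distrib exp_Euler flip: sin_of_real cos_of_real)
    then show ?thesis using False R by (simp add: dirichlet_def)
  qed
  finally show ?thesis by (simp add: set_lebesgue_integral_def)
qed

lemma Si_scaled_tendsto: "((\<lambda>R. 2 * Si (R * w)) \<longlongrightarrow> pi * sgn w) at_top"
proof -
  consider "w > 0" | "w = 0" | "w < 0" by linarith
  then show ?thesis
  proof cases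
    case 1
    have "((\<lambda>R. Si (R * w)) \<longlongrightarrow> pi / 2) at_top"
      by (rule filterlim_compose[OF Si_at_top])
        (intro filterlim_at_top_mult_tendsto_pos[OF tendsto_const 1 filterlim_ident])
    from tendsto_mult[OF tendsto_const[of 2] this] 1 show ?thesis by simp
  next
    case 2
    then show ?thesis using Si_neg[of 0] by simp
  next
    case 3
    have "((\<lambda>R. Si (R * - w)) \<longlongrightarrow> pi / 2) at_top"
      by (rule filterlim_compose[OF Si_at_top])
        (intro filterlim_at_top_mult_tendsto_pos[OF tendsto_const _ filterlim_ident], use 3 in auto)
    from tendsto_mult[OF tendsto_const[of "-2"] this]
    have "((\<lambda>R. - 2 * Si (R * - w)) \<longlongrightarrow> pi * sgn w) at_top"
      using 3 by simp
    moreover have "\<forall>\<^sub>F R in at_top. - 2 * Si (R * - w) = 2 * Si (R * w)"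
      using eventually_ge_at_top[of 0]
    proof eventually_elim
      case (elim R)
      then have "Si (- (R * - w)) = - Si (R * - w)"
        using 3 by (intro Si_neg) (auto simp: mult_nonneg_nonpos)
      then show ?case by simp
    qed
    ultimately show ?thesis by (rule Lim_transform_eventually)
  qed
qed

lemma abs_mult_Si_le:
  assumes "\<And>T. \<bar>Si T\<bar> \<le> B"
  shows "\<bar>c * (2 * Si T)\<bar> \<le> \<bar>c\<bar> * (2 * B)"
  using assms[of T] unfolding abs_mult by (intro mult_left_mono) auto

context integrable_C1
begin

lemma integrable_mult_dirichlet: "integrable lborel (\<lambda>v. g v * dirichlet R (y - v))"
proof (rule Bochner_Integration.integrable_bound)
  show "integrable lborel (\<lambda>v. g v * (2 * \<bar>R\<bar>))" using integrable by simp
  show "AE v in lborel. norm (g v * dirichlet R (y - v)) \<le> norm (g v * (2 * \<bar>R\<bar>))"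
    using abs_dirichlet_le by (auto simp: abs_mult intro!: mult_left_mono)
qed simp

lemma integrable_deriv_mult_Si: "integrable lborel (\<lambda>v. g' v * (2 * Si (R * (y - v))))"
proof -
  obtain B where B: "\<And>T. \<bar>Si T\<bar> \<le> B" using bounded_Si by blast
  show ?thesis
  proof (rule Bochner_Integration.integrable_bound)
    show "integrable lborel (\<lambda>v. \<bar>g' v\<bar> * (2 * B))" using integrable_deriv by simp
    show "AE v in lborel. norm (g' v * (2 * Si (R * (y - v)))) \<le> norm (\<bar>g' v\<bar> * (2 * B))"
      using abs_mult_Si_le[OF B] by (intro AE_I2) (metis abs_ge_self order_trans real_norm_def)
  qed simp
qed

text \<open>
  Integration by parts on the whole line; the boundary terms vanish because $g$ tends to $0$ at
  $\pm\infty$ and the sine integral is bounded. It replaces the Dirichlet kernel, whose $L^1$ norm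
  is infinite, by a factor bounded uniformly in $R$.
\<close>

lemma integral_mult_dirichlet:
  "(LBINT v. g v * dirichlet R (y - v)) = (LBINT v. g' v * (2 * Si (R * (y - v))))"
proof -
  define F where "F v = g v * (2 * Si (R * (y - v)))" for v
  define F' where "F' v = g' v * (2 * Si (R * (y - v))) - g v * dirichlet R (y - v)" for v
  obtain B where B: "\<And>T. \<bar>Si T\<bar> \<le> B" using bounded_Si by blast
  have null: "(F \<longlongrightarrow> 0) G" if "(g \<longlongrightarrow> 0) G" for G
  proof (rule Lim_null_comparison)
    show "\<forall>\<^sub>F v in G. norm (F v) \<le> \<bar>g v\<bar> * (2 * B)"
      unfolding F_def real_norm_def by (intro always_eventually allI abs_mult_Si_le B)
    show "((\<lambda>v. \<bar>g v\<bar> * (2 * B)) \<longlongrightarrow> 0) G"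
      using tendsto_mult_left_zero[OF tendsto_rabs_zero[OF that]] .
  qed
  have "(LBINT v=-\<infinity>..\<infinity>. F' v) = 0 - 0"
  proof (rule interval_integral_FTC_integrable[where F = F])
    fix v :: real
    have "(F has_real_derivative F' v) (at v)"
      unfolding F_def F'_def dirichlet_def
      by (rule derivative_eq_intros deriv DERIV_chain2[OF DERIV_Si] refl | simp)+
    then show "(F has_vector_derivative F' v) (at v)"
      by (simp add: has_real_derivative_iff_has_vector_derivative)
    have "isCont (\<lambda>v. Si (R * (y - v))) v" "isCont (\<lambda>v. dirichlet R (y - v)) v"
      by (rule continuous_within_compose3[OF isCont_Si] continuous_within_compose3[OF isCont_dirichlet];
          intro continuous_intros)+
    then show "isCont F' v"
      using cont cont_deriv unfolding F'_def
      by (intro continuous_intros) (auto simp: continuous_on_eq_continuous_at)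
  next
    show "set_integrable lborel (einterval (- \<infinity>) \<infinity>) F'"
      unfolding F'_def set_integrable_def
      using integrable_mult_dirichlet integrable_deriv_mult_Si by simp
  qed (use null tendsto_at_bot tendsto_at_top in \<open>auto simp: ereal_tendsto_simps\<close>)
  then have "(LBINT v. F' v) = 0"
    by (simp add: interval_lebesgue_integral_def set_lebesgue_integral_def)
  then show ?thesis
    unfolding F'_def using integrable_mult_dirichlet integrable_deriv_mult_Si by simp
qed

text \<open>
  The bound does not depend on $R$ or $y$; applied to slices of a function on the plane, it is the
  dominating function for the limit $R_2 \to \infty$.
\<close>

lemma abs_integral_mult_dirichlet_le:
  assumes "\<And>T. \<bar>Si T\<bar> \<le> B"
  shows "\<bar>LBINT v. g v * dirichlet R (y - v)\<bar> \<le> 2 * B * (LBINT v. \<bar>g' v\<bar>)"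
proof -
  have "\<bar>LBINT v. g v * dirichlet R (y - v)\<bar> \<le> (LBINT v. \<bar>g' v * (2 * Si (R * (y - v)))\<bar>)"
    unfolding integral_mult_dirichlet by (rule integral_abs_bound)
  also have "\<dots> \<le> (LBINT v. \<bar>g' v\<bar> * (2 * B))"
  proof (rule integral_mono_AE')
    show "AE v in lborel. \<bar>g' v * (2 * Si (R * (y - v)))\<bar> \<le> \<bar>g' v\<bar> * (2 * B)"
      by (intro AE_I2 abs_mult_Si_le assms)
    have "0 \<le> B" using assms[of 0] by linarith
    then show "AE v in lborel. 0 \<le> \<bar>g' v\<bar> * (2 * B)"
      by simp
  qed (use integrable_deriv in simp)
  finally show ?thesis by (simp add: mult_ac)
qed

text \<open>
  Fourier inversion on the line. After the integration by parts, dominated convergence applies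
  with a constant multiple of $|g'|$ as the majorant.
\<close>

lemma dirichlet_tendsto: "((\<lambda>R. LBINT v. g v * dirichlet R (y - v)) \<longlongrightarrow> 2 * pi * g y) at_top"
proof -
  obtain B where B: "\<And>T. \<bar>Si T\<bar> \<le> B" using bounded_Si by blast
  have "((\<lambda>R. LBINT v. g' v * (2 * Si (R * (y - v)))) \<longlongrightarrow> (LBINT v. g' v * (pi * sgn (y - v)))) at_top"
  proof (rule integral_dominated_convergence_at_top)
    show "integrable lborel (\<lambda>v. \<bar>g' v\<bar> * (2 * B))" using integrable_deriv by simp
    show "\<forall>\<^sub>F R in at_top. AE v in lborel. norm (g' v * (2 * Si (R * (y - v)))) \<le> \<bar>g' v\<bar> * (2 * B)"
      unfolding real_norm_def by (intro always_eventually allI AE_I2 abs_mult_Si_le B)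
    show "AE v in lborel. ((\<lambda>R. g' v * (2 * Si (R * (y - v)))) \<longlongrightarrow> g' v * (pi * sgn (y - v))) at_top"
      by (intro AE_I2 tendsto_mult tendsto_const Si_scaled_tendsto)
  qed auto
  also have "(LBINT v. g' v * (pi * sgn (y - v))) = pi * (LBINT v. g' v * sgn (y - v))"
    by (subst integral_mult_right_zero[symmetric]) (simp add: mult_ac)
  finally show ?thesis
    unfolding integral_mult_dirichlet integral_deriv_mult_sgn by (simp add: mult_ac)
qed

end

section \<open>From the line to the plane\<close>

text \<open>
  Fubini is applicable because $t$ is confined to a bounded interval and the exponential has
  modulus one. The measure space and the phase \<open>\<phi>\<close> are arbitrary so that either of the two
  frequency variables can be integrated out, over the plane, with its own phase.
\<close>

lemma integral_exp_phase:
  fixes h :: "'a \<Rightarrow> complex" and \<phi> :: "'a \<Rightarrow> real"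
  assumes "sigma_finite_measure M" and R: "0 \<le> R"
    and h: "integrable M h" and \<phi> [measurable]: "\<phi> \<in> borel_measurable M"
  shows "(LBINT t:{-R..R}. \<integral>z. exp (\<i> * complex_of_real (t * \<phi> z)) * h z \<partial>M) =
    (\<integral>z. complex_of_real (dirichlet R (\<phi> z)) * h z \<partial>M)"
proof -
  interpret M: sigma_finite_measure M by fact
  interpret P: pair_sigma_finite lborel M ..
  note [measurable] = borel_measurable_integrable[OF h]
  let ?k = "\<lambda>t z. indicator {-R..R} t *\<^sub>R (exp (\<i> * complex_of_real (t * \<phi> z)) * h z)"
  have "integrable (lborel \<Otimes>\<^sub>M M) (\<lambda>(t, z). indicator {-R..R} t *\<^sub>R h z)"
  proof (rule P.Fubini_integrable)
    show "integrable lborel (\<lambda>t. \<integral>z. norm (case (t, z) of (t, z) \<Rightarrow> indicator {-R..R} t *\<^sub>R h z) \<partial>M)"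
      using integrable_real_indicator[of "{-R..R}" lborel] R by (simp add: emeasure_lborel_Icc_eq)
  qed (use h in auto)
  then have int: "integrable (lborel \<Otimes>\<^sub>M M) (case_prod ?k)"
    by (rule Bochner_Integration.integrable_bound) (auto simp: norm_mult split: split_indicator)
  have "(LBINT t:{-R..R}. \<integral>z. exp (\<i> * complex_of_real (t * \<phi> z)) * h z \<partial>M) =
      (LBINT t. \<integral>z. ?k t z \<partial>M)"
    by (simp add: set_lebesgue_integral_def)
  also have "\<dots> = (\<integral>z. (LBINT t. ?k t z) \<partial>M)"
    using P.Fubini_integral[OF int] by simp
  also have "\<dots> = (\<integral>z. (LBINT t:{-R..R}. exp (\<i> * complex_of_real (t * \<phi> z))) * h z \<partial>M)"
    by (intro Bochner_Integration.integral_cong)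
      (simp_all add: set_lebesgue_integral_def flip: integral_mult_left_zero)
  finally show ?thesis
    unfolding integral_exp_eq_dirichlet[OF R] .
qed

lemma integrable_mult_bounded:
  fixes k h :: "'a \<Rightarrow> 'b::{real_normed_field, second_countable_topology, banach}"
  assumes h: "integrable M h" and [measurable]: "k \<in> borel_measurable M"
    and bound: "\<And>z. norm (k z) \<le> C"
  shows "integrable M (\<lambda>z. k z * h z)"
proof (rule Bochner_Integration.integrable_bound)
  have "0 \<le> C" using bound norm_ge_zero order_trans by blast
  show "integrable M (\<lambda>z. C * norm (h z))" using h by simp
  show "(\<lambda>z. k z * h z) \<in> borel_measurable M"
    using borel_measurable_integrable[OF h] by measurable
  show "AE z in M. norm (k z * h z) \<le> norm (C * norm (h z))"
    using bound \<open>0 \<le> C\<close> by (intro AE_I2) (simp add: norm_mult mult_right_mono)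
qed

lemma borel_measurable_coordinates [measurable]:
  "fst \<in> borel_measurable (borel :: (real \<times> real) measure)"
  "snd \<in> borel_measurable (borel :: (real \<times> real) measure)"
  by (auto intro!: borel_measurable_continuous_onI continuous_intros)

text \<open>
  In the truncated inversion integral the phases combine to
  $e^{is(x-u)} e^{it(y-v)}$, so applying the exchange lemma first in $t$ and then in $s$
  leaves one absolutely convergent integral of \<open>f\<close> against a product of Dirichlet kernels.
\<close>

lemma truncated_inversion_eq_dirichlet:
  fixes f :: "real \<times> real \<Rightarrow> real"
  assumes f: "integrable lborel f" and R: "0 \<le> R1" "0 \<le> R2"
  shows "(LBINT s:{-R1..R1}. LBINT t:{-R2..R2}.
            exp (\<i> * complex_of_real (x * s + y * t)) *
            (LBINT u. LBINT v.
               exp (- \<i> * complex_of_real (s * u + t * v)) * complex_of_real (f (u, v)))) =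
    complex_of_real (LBINT z. dirichlet R1 (x - fst z) * (dirichlet R2 (y - snd z) * f z))"
proof -
  note [measurable] = borel_measurable_integrable[OF f, simplified]
  have fC: "integrable lborel (\<lambda>z. complex_of_real (f z))"
    using f by simp
  have sf: "sigma_finite_measure (lborel :: (real \<times> real) measure)" ..
  have transform: "(LBINT u. LBINT v. exp (- \<i> * complex_of_real (s * u + t * v)) * complex_of_real (f (u, v))) =
      (LBINT z. exp (- \<i> * complex_of_real (s * fst z + t * snd z)) * complex_of_real (f z))" for s t
  proof -
    have "integrable lborel (\<lambda>z. exp (- \<i> * complex_of_real (s * fst z + t * snd z)) * complex_of_real (f z))"
      by (rule integrable_mult_bounded[OF fC, where C = 1]) auto
    from lborel_pair.integral_fst'[OF this[folded lborel_prod]]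
    show ?thesis by (simp add: lborel_prod)
  qed
  have inner: "(LBINT t:{-R2..R2}. exp (\<i> * complex_of_real (x * s + y * t)) *
      (LBINT z. exp (- \<i> * complex_of_real (s * fst z + t * snd z)) * complex_of_real (f z))) =
      (LBINT z. exp (\<i> * complex_of_real (s * (x - fst z))) *
        (complex_of_real (dirichlet R2 (y - snd z)) * complex_of_real (f z)))" for s
  proof -
    let ?h = "\<lambda>z. exp (\<i> * complex_of_real (s * (x - fst z))) * complex_of_real (f z)"
    have h: "integrable lborel ?h"
      by (rule integrable_mult_bounded[OF fC, where C = 1]) auto
    have "exp (\<i> * complex_of_real (x * s + y * t)) *
        (LBINT z. exp (- \<i> * complex_of_real (s * fst z + t * snd z)) * complex_of_real (f z)) =
        (LBINT z. exp (\<i> * complex_of_real (t * (y - snd z))) * ?h z)" for t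
      unfolding integral_mult_right_zero[symmetric] mult.assoc[symmetric] exp_add[symmetric]
      by (simp add: algebra_simps)
    then show ?thesis
      using integral_exp_phase[OF sf R(2) h, of "\<lambda>z. y - snd z"] by (simp add: mult_ac)
  qed
  have "integrable lborel (\<lambda>z. complex_of_real (dirichlet R2 (y - snd z)) * complex_of_real (f z))"
    using abs_dirichlet_le by (intro integrable_mult_bounded[OF fC, where C = "2 * \<bar>R2\<bar>"]) auto
  from integral_exp_phase[OF sf R(1) this, of "\<lambda>z. x - fst z"]
  show ?thesis
    unfolding transform inner by (simp flip: of_real_mult)
qed

lemma AE_integrable_C1_slice:
  fixes h h' :: "real \<times> real \<Rightarrow> real"
  assumes deriv: "\<And>u v. ((\<lambda>v. h (u, v)) has_real_derivative h' (u, v)) (at v)"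
    and cont: "continuous_on UNIV h'"
    and int: "integrable lborel h" "integrable lborel h'"
  shows "AE u in lborel. integrable_C1 (\<lambda>v. h (u, v)) (\<lambda>v. h' (u, v))"
  using lborel_pair.AE_integrable_fst'[OF int(1)[folded lborel_prod]]
    lborel_pair.AE_integrable_fst'[OF int(2)[folded lborel_prod]]
proof eventually_elim
  case (elim u)
  have "continuous_on UNIV (\<lambda>v. h' (u, v))"
    by (intro continuous_on_compose2[OF cont] continuous_intros) auto
  with elim deriv show ?case by unfold_locales
qed

text \<open>
  Fixing \<open>y\<close> restricts \<open>h\<close> to a null set of the plane, so integrability needs the derivative:
  for almost every \<open>u\<close> the value $h(u,y)$ is bounded by the integral of $|h| + |h'|$ over the whole
  vertical line through $u$, and that integral is integrable in $u$.
\<close>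

lemma integrable_slice:
  fixes h h' :: "real \<times> real \<Rightarrow> real"
  assumes deriv: "\<And>u v. ((\<lambda>v. h (u, v)) has_real_derivative h' (u, v)) (at v)"
    and cont: "continuous_on UNIV h" "continuous_on UNIV h'"
    and int: "integrable lborel h" "integrable lborel h'"
  shows "integrable lborel (\<lambda>u. h (u, y))"
proof (rule Bochner_Integration.integrable_bound)
  have "integrable lborel (\<lambda>z. \<bar>h z\<bar> + \<bar>h' z\<bar>)"
    using int by auto
  from lborel_pair.integrable_fst'[OF this[folded lborel_prod]]
  show "integrable lborel (\<lambda>u. LBINT v. \<bar>h (u, v)\<bar> + \<bar>h' (u, v)\<bar>)" .
  have "continuous_on UNIV (\<lambda>u. h (u, y))"
    by (intro continuous_on_compose2[OF cont(1)] continuous_intros) auto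
  then show "(\<lambda>u. h (u, y)) \<in> borel_measurable lborel"
    by (simp add: borel_measurable_continuous_onI)
  show "AE u in lborel. norm (h (u, y)) \<le> norm (LBINT v. \<bar>h (u, v)\<bar> + \<bar>h' (u, v)\<bar>)"
    using AE_integrable_C1_slice[OF deriv cont(2) int]
  proof eventually_elim
    case (elim u)
    from integrable_C1.abs_le_integral[OF elim, of y] show ?case by simp
  qed
qed

text \<open>
  For fixed $R_1$ the kernel in $u$ is bounded, and the inner integral over $v$ converges for almost
  every $u$ by inversion on the line while staying below a multiple of $\int |f'(u,v)|\,dv$.
\<close>

lemma dirichlet_tendsto_slice:
  fixes f f' :: "real \<times> real \<Rightarrow> real"
  assumes deriv: "\<And>u v. ((\<lambda>v. f (u, v)) has_real_derivative f' (u, v)) (at v)"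
    and cont: "continuous_on UNIV f" "continuous_on UNIV f'"
    and int: "integrable lborel f" "integrable lborel f'"
  shows "((\<lambda>R2. LBINT z. dirichlet R1 (x - fst z) * (dirichlet R2 (y - snd z) * f z)) \<longlongrightarrow>
    2 * pi * (LBINT u. f (u, y) * dirichlet R1 (x - u))) at_top"
proof -
  obtain B where B: "\<And>T. \<bar>Si T\<bar> \<le> B" using bounded_Si by blast
  note [measurable] = borel_measurable_continuous_onI[OF cont(1)]
  have slice: "(\<lambda>u. f (u, y)) \<in> borel_measurable borel"
    by (intro borel_measurable_continuous_onI continuous_on_compose2[OF cont(1)] continuous_intros) auto
  let ?inner = "\<lambda>R2 u. LBINT v. f (u, v) * dirichlet R2 (y - v)"
  have kint: "integrable lborel (\<lambda>z. dirichlet R2 (y - snd z) * f z)" for R2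
    using abs_dirichlet_le by (intro integrable_mult_bounded[OF int(1), where C = "2 * \<bar>R2\<bar>"]) auto
  have iterated: "(LBINT z. dirichlet R1 (x - fst z) * (dirichlet R2 (y - snd z) * f z)) =
      (LBINT u. dirichlet R1 (x - u) * ?inner R2 u)" for R2
  proof -
    have "integrable lborel (\<lambda>z. dirichlet R1 (x - fst z) * (dirichlet R2 (y - snd z) * f z))"
      using abs_dirichlet_le by (intro integrable_mult_bounded[OF kint, where C = "2 * \<bar>R1\<bar>"]) auto
    from lborel_pair.integral_fst'[OF this[folded lborel_prod]]
    show ?thesis by (simp add: lborel_prod mult.commute[of _ "f _"])
  qed
  have "((\<lambda>R2. LBINT u. dirichlet R1 (x - u) * ?inner R2 u) \<longlongrightarrow>
      (LBINT u. dirichlet R1 (x - u) * (2 * pi * f (u, y)))) at_top"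
  proof (rule integral_dominated_convergence_at_top)
    have "integrable lborel (\<lambda>z. \<bar>f' z\<bar>)" using int by simp
    from lborel_pair.integrable_fst'[OF this[folded lborel_prod]]
    show "integrable lborel (\<lambda>u. 2 * \<bar>R1\<bar> * (2 * B * (LBINT v. \<bar>f' (u, v)\<bar>)))"
      by simp
    show "\<forall>\<^sub>F R2 in at_top. AE u in lborel.
        norm (dirichlet R1 (x - u) * ?inner R2 u) \<le> 2 * \<bar>R1\<bar> * (2 * B * (LBINT v. \<bar>f' (u, v)\<bar>))"
    proof (rule always_eventually, rule allI)
      fix R2
      show "AE u in lborel.
          norm (dirichlet R1 (x - u) * ?inner R2 u) \<le> 2 * \<bar>R1\<bar> * (2 * B * (LBINT v. \<bar>f' (u, v)\<bar>))"
        using AE_integrable_C1_slice[OF deriv cont(2) int]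
      proof eventually_elim
        case (elim u)
        show ?case
          unfolding real_norm_def abs_mult[of "dirichlet _ _"]
          by (intro mult_mono abs_dirichlet_le integrable_C1.abs_integral_mult_dirichlet_le[OF elim B]) auto
      qed
    qed
    show "AE u in lborel. ((\<lambda>R2. dirichlet R1 (x - u) * ?inner R2 u) \<longlongrightarrow>
        dirichlet R1 (x - u) * (2 * pi * f (u, y))) at_top"
      using AE_integrable_C1_slice[OF deriv cont(2) int]
    proof eventually_elim
      case (elim u)
      show ?case by (intro tendsto_mult tendsto_const integrable_C1.dirichlet_tendsto[OF elim])
    qed
    show "(\<lambda>u. dirichlet R1 (x - u) * ?inner R2 u) \<in> borel_measurable lborel" for R2
      using borel_measurable_integrable[OF lborel_pair.integrable_fst'[OF kint[folded lborel_prod]]]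
      by (simp add: mult_ac)
  qed (use slice in simp)
  then show ?thesis
    unfolding iterated by (simp add: mult_ac flip: integral_mult_right_zero)
qed

theorem theorem3p1:
  fixes f :: "real \<times> real \<Rightarrow> real" and x y :: real
  assumes "C2_plane f"
    and "integrable lborel f"
    and "integrable lborel (partial_x f)"
    and "integrable lborel (partial_y f)"
    and "integrable lborel (partial_y (partial_x f))"
  shows "\<exists>(L :: real \<Rightarrow> complex) (l :: complex).
    (\<forall>R1>0.
      ((\<lambda>R2::real.
          LBINT s:{-R1..R1}. LBINT t:{-R2..R2}.
            exp (\<i> * complex_of_real (x * s + y * t)) *
            (LBINT u. LBINT v.
               exp (- \<i> * complex_of_real (s * u + t * v)) * complex_of_real (f (u, v))))
        \<longlongrightarrow> L R1) at_top) \<and>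
    (L \<longlongrightarrow> l) at_top \<and>
    complex_of_real (f (x, y)) = 1 / (2 * complex_of_real pi)\<^sup>2 * l"
proof -
  have C1: "C1_plane f" "C1_plane (partial_x f)"
    using assms(1) by (auto simp: C2_plane_def)
  have deriv_x: "((\<lambda>u. f (u, v)) has_real_derivative partial_x f (u, v)) (at u)" for u v
    using C1(1) by (simp add: C1_plane_def partial_x_def DERIV_deriv_iff_field_differentiable)
  have deriv_y: "((\<lambda>v. h (u, v)) has_real_derivative partial_y h (u, v)) (at v)" if "C1_plane h" for h u v
    using that by (simp add: C1_plane_def partial_y_def DERIV_deriv_iff_field_differentiable)
  have cont: "continuous_on UNIV h" "continuous_on UNIV (partial_y h)" if "C1_plane h" for h
    using that by (auto simp: C1_plane_def)
  \<comment> \<open>The horizontal slice through the given point: its integrability comes from the vertical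
    derivatives $f_y$ and $f_{xy}$, and the mixed derivative is only ever taken in the order
    first $x$, then $y$.\<close>
  interpret slice: integrable_C1 "\<lambda>u. f (u, y)" "\<lambda>u. partial_x f (u, y)"
  proof
    show "((\<lambda>u. f (u, y)) has_real_derivative partial_x f (v, y)) (at v)" for v
      by (rule deriv_x)
    show "continuous_on UNIV (\<lambda>u. partial_x f (u, y))"
      by (intro continuous_on_compose2[OF cont(1)[OF C1(2)]] continuous_intros) auto
    show "integrable lborel (\<lambda>u. f (u, y))"
      by (rule integrable_slice[OF deriv_y[OF C1(1)] cont[OF C1(1)] assms(2,4)])
    show "integrable lborel (\<lambda>u. partial_x f (u, y))"
      by (rule integrable_slice[OF deriv_y[OF C1(2)] cont[OF C1(2)] assms(3,5)])
  qed
  define L where "L R1 = 2 * pi * (LBINT u. f (u, y) * dirichlet R1 (x - u))" for R1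
  show ?thesis
  proof (intro exI conjI allI impI)
    fix R1 :: real
    assume R1: "0 < R1"
    let ?D = "\<lambda>R2. LBINT z. dirichlet R1 (x - fst z) * (dirichlet R2 (y - snd z) * f z)"
    have "((\<lambda>R2. complex_of_real (?D R2)) \<longlongrightarrow> complex_of_real (L R1)) at_top"
      unfolding L_def
      by (intro tendsto_of_real dirichlet_tendsto_slice[OF deriv_y[OF C1(1)] cont[OF C1(1)] assms(2,4)])
    moreover have "\<forall>\<^sub>F R2 in at_top. complex_of_real (?D R2) =
        (LBINT s:{-R1..R1}. LBINT t:{-R2..R2}.
            exp (\<i> * complex_of_real (x * s + y * t)) *
            (LBINT u. LBINT v.
               exp (- \<i> * complex_of_real (s * u + t * v)) * complex_of_real (f (u, v))))"
      \<comment> \<open>For negative $R_2$ the interval $[-R_2,R_2]$ is empty while the kernel is not zero.\<close>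
      using eventually_ge_at_top[of 0]
      by eventually_elim
        (rule truncated_inversion_eq_dirichlet[OF assms(2), symmetric], use R1 in auto)
    ultimately show "((\<lambda>R2::real.
          LBINT s:{-R1..R1}. LBINT t:{-R2..R2}.
            exp (\<i> * complex_of_real (x * s + y * t)) *
            (LBINT u. LBINT v.
               exp (- \<i> * complex_of_real (s * u + t * v)) * complex_of_real (f (u, v))))
        \<longlongrightarrow> complex_of_real (L R1)) at_top"
      by (rule Lim_transform_eventually)
  next
    show "((\<lambda>R1. complex_of_real (L R1)) \<longlongrightarrow> complex_of_real (2 * pi * (2 * pi * f (x, y)))) at_top"
      unfolding L_def by (intro tendsto_of_real tendsto_mult[OF tendsto_const] slice.dirichlet_tendsto)
    show "complex_of_real (f (x, y)) =
        1 / (2 * complex_of_real pi)\<^sup>2 * complex_of_real (2 * pi * (2 * pi * f (x, y)))"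
      by (simp add: power2_eq_square)
  qed
qed

end
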